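(* Let $p>3$ be a prime. Then there exist at least $p+8$ pairwise non-isomorphic Beauville groups of order $p^5$.
   Context: Let $G$ be a finite group with identity $e$. For $x,y\in G$ put $$\Sigma(x,y):=\bigcup_{i=1}^{|G|}\bigcup_{g\in G}\{(x^i)^g,(y^i)^g,((xy)^i)^g\},$$ where $a^g$ denotes the conjugate $g^{-1}ag$. A Beauville structure for $G$ is a pair of generating sets $\{x_1,y_1\},\{x_2,y_2\}$ of $G$ (i.e. $\langle x_1,y_1\rangle=\langle x_2,y_2\rangle=G$) such that $\Sigma(x_1,y_1)\cap\Sigma(x_2,y_2)=\{e\}$. $G$ is a Beauville group if there exists a Beauville structure for $G$. *)

theory Defs
  imports "HOL-Algebra.Algebra" "HOL-Computational_Algebra.Primes"
begin

definition conjugate :: "('a, 'b) monoid_scheme \<Rightarrow> 'a \<Rightarrow> 'a \<Rightarrow> 'a" where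
  "conjugate G a g = inv\<^bsub>G\<^esub> g \<otimes>\<^bsub>G\<^esub> a \<otimes>\<^bsub>G\<^esub> g"

definition beauville_Sigma :: "('a, 'b) monoid_scheme \<Rightarrow> 'a \<Rightarrow> 'a \<Rightarrow> 'a set" where
  "beauville_Sigma G x y =
     (\<Union>i\<in>{1..order G}. \<Union>g\<in>carrier G.
        {conjugate G (x [^]\<^bsub>G\<^esub> (i::nat)) g,
         conjugate G (y [^]\<^bsub>G\<^esub> i) g,
         conjugate G ((x \<otimes>\<^bsub>G\<^esub> y) [^]\<^bsub>G\<^esub> i) g})"

text \<open>
  The generating sets are given by ordered pairs. The order is immaterial:
  \<open>x y\<close> and \<open>y x\<close> are conjugate, so \<open>beauville_Sigma\<close> is symmetric in its
  last two arguments.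
\<close>
definition beauville_structure ::
    "('a, 'b) monoid_scheme \<Rightarrow> 'a \<times> 'a \<Rightarrow> 'a \<times> 'a \<Rightarrow> bool" where
  "beauville_structure G = (\<lambda>(x1, y1) (x2, y2).
     {x1, y1, x2, y2} \<subseteq> carrier G \<and>
     generate G {x1, y1} = carrier G \<and>
     generate G {x2, y2} = carrier G \<and>
     beauville_Sigma G x1 y1 \<inter> beauville_Sigma G x2 y2 = {\<one>\<^bsub>G\<^esub>})"

definition beauville_group :: "('a, 'b) monoid_scheme \<Rightarrow> bool" where
  "beauville_group G \<longleftrightarrow>
     group G \<and> finite (carrier G) \<and> (\<exists>s t. beauville_structure G s t)"

end

theory Submission
  imports Defs "HOL-Library.Countable" "HOL-Number_Theory.Cong"
begin

text \<open>
  For an integer 2x2 matrix \<open>C\<close>, take the Lie ring \<open>(Z/p^2)^2 + Z/p\<close> in which two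
  vectors \<open>v\<close>, \<open>w\<close> have bracket \<open>det(v, w)\<close> in \<open>Z/p\<close> and \<open>v\<close> has bracket \<open>p C v\<close> with
  the generator of \<open>Z/p\<close>. It is nilpotent of class at most 3 and \<open>p > 3\<close>, so the
  Baker-Campbell-Hausdorff formula makes it a group \<open>G(C)\<close> of order \<open>p^5\<close>, in which the
  \<open>n\<close>-th power of an element is its \<open>n\<close>-fold multiple. Together with the free class-3
  two-generator group of exponent \<open>p\<close>, all these groups are quotients of one group
  on \<open>Z^5\<close>, and all computations are polynomial identities there.

  Modulo \<open>p\<close>, conjugation does not change the \<open>(Z/p)^2\<close>-component of an element, and a power
  of a generator with zero component is central of the form \<open>p v\<close>. Hence pairs whose three directions in the projective line are disjoint give a
  Beauville structure: \<open>(1,0), (0,1), (1,1)\<close> and \<open>(1,2), (1,-1), (2,1)\<close>, which are distinct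
  because \<open>p > 3\<close>.

  An isomorphism \<open>G(C) \<rightarrow> G(C')\<close> acting as \<open>P\<close> on the Frattini quotient satisfies
  \<open>P C = det P C' P\<close> modulo \<open>p\<close>, as one sees by comparing \<open>p\<close>-th powers with the commutators
  \<open>[x, [x, y]]\<close> and \<open>[y, [x, y]]\<close>. So the trace scales by \<open>det P\<close> and the determinant by
  its square, and \<open>p + 7\<close> matrices with pairwise inequivalent data remain; the group of
  exponent \<open>p\<close> is the last one.
\<close>

section \<open>The Baker-Campbell-Hausdorff group on five integer coordinates\<close>

type_synonym int5 = "int \<times> int \<times> int \<times> int \<times> int"
type_synonym int4 = "int \<times> int \<times> int \<times> int"

text \<open>
  Coordinates \<open>(v, k, u)\<close> with \<open>v = (a, b)\<close> and \<open>u = (x, y)\<close> stand for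
  \<open>v + (k/2) z + u/12\<close> in the free nilpotent Lie algebra of class 3, where \<open>z\<close> is the bracket
  of the two generators and \<open>u\<close> lies in the top layer, spanned by the brackets of the
  generators with \<open>z\<close>. This rescaling clears all denominators of the
  Baker-Campbell-Hausdorff formula.
\<close>

fun bch_mult :: "int5 \<Rightarrow> int5 \<Rightarrow> int5" where
  "bch_mult (a, b, k, x, y) (a', b', k', x', y') =
     (let d = a * b' - b * a' in
      (a + a', b + b', k + k' + d,
       x + x' + 3 * (k' * a - k * a') + d * (a - a'),
       y + y' + 3 * (k' * b - k * b') + d * (b - b')))"

definition bch_group :: "int5 monoid" where
  "bch_group = \<lparr>carrier = UNIV, monoid.mult = bch_mult, one = (0, 0, 0, 0, 0)\<rparr>"

lemma bch_group_simps [simp]: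
  "carrier bch_group = UNIV" "monoid.mult bch_group = bch_mult" "one bch_group = (0, 0, 0, 0, 0)"
  by (simp_all add: bch_group_def)

interpretation bch_group: group bch_group
proof (rule groupI)
  fix s t w
  show "s \<otimes>\<^bsub>bch_group\<^esub> t \<otimes>\<^bsub>bch_group\<^esub> w = s \<otimes>\<^bsub>bch_group\<^esub> (t \<otimes>\<^bsub>bch_group\<^esub> w)"
    by (cases s; cases t; cases w) (simp add: Let_def algebra_simps)
next
  fix s :: int5
  obtain a b k x y where "s = (a, b, k, x, y)" by (cases s)
  then show "\<exists>t\<in>carrier bch_group. t \<otimes>\<^bsub>bch_group\<^esub> s = \<one>\<^bsub>bch_group\<^esub>"
    by (intro bexI[of _ "(-a, -b, -k, -x, -y)"]) (simp_all add: Let_def)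
qed (auto simp: Let_def)

lemma inv_bch_group [simp]: "inv\<^bsub>bch_group\<^esub> (a, b, k, x, y) = (-a, -b, -k, -x, -y)"
  by (rule bch_group.inv_equality) (simp_all add: Let_def)

lemma pow_bch_group [simp]:
  "(a, b, k, x, y) [^]\<^bsub>bch_group\<^esub> (n::nat) = (n * a, n * b, n * k, n * x, n * y)"
  by (induction n) (simp_all add: Let_def algebra_simps)

lemma conjugate_bch_group:
  "conjugate bch_group (a, b, k, x, y) (a', b', k', x', y') =
     (let d = a * b' - b * a' in
      (a, b, k + 2 * d, x + 6 * (k' * a - k * a' - d * a'), y + 6 * (k' * b - k * b' - d * b')))"
  by (simp add: conjugate_def Let_def algebra_simps)

lemma int_pow_bch_group [simp]:
  "(a, b, k, x, y) [^]\<^bsub>bch_group\<^esub> (n::int) = (n * a, n * b, n * k, n * x, n * y)"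
  by (cases "n < 0") (simp_all add: int_pow_def2)

section \<open>Commutators and generation in the integer group\<close>

definition commutator :: "('a, 'b) monoid_scheme \<Rightarrow> 'a \<Rightarrow> 'a \<Rightarrow> 'a" where
  "commutator G x y = inv\<^bsub>G\<^esub> x \<otimes>\<^bsub>G\<^esub> conjugate G x y"

lemma commutator_bch_group:
  "commutator bch_group (a, b, k, x, y) (a', b', k', x', y') =
     (let d = a * b' - b * a' in
      (0, 0, 2 * d, 6 * (k' * a - k * a' - d * a') - 3 * 2 * d * a,
       6 * (k' * b - k * b' - d * b') - 3 * 2 * d * b))"
  by (simp add: commutator_def conjugate_bch_group Let_def algebra_simps)

text \<open>In class 3 a double commutator is the Lie bracket of \<open>v\<close> with
  \<open>d z\<close>, so the lower layers and all correction terms drop out; the 12 is the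
  denominator chosen for the top layer.\<close>

lemma commutator_commutator_bch_group:
  "commutator bch_group (a, b, k, x, y) (commutator bch_group (a, b, k, x, y) (a', b', k', x', y')) =
     (let d = a * b' - b * a' in (0, 0, 0, 12 * d * a, 12 * d * b))"
  "commutator bch_group (a', b', k', x', y') (commutator bch_group (a, b, k, x, y) (a', b', k', x', y')) =
     (let d = a * b' - b * a' in (0, 0, 0, 12 * d * a', 12 * d * b'))"
  by (simp_all add: commutator_def conjugate_bch_group Let_def algebra_simps)

lemma (in group_hom) hom_conjugate:
  "\<lbrakk>x \<in> carrier G; g \<in> carrier G\<rbrakk> \<Longrightarrow> h (conjugate G x g) = conjugate H (h x) (h g)"
  by (simp add: conjugate_def)

lemma (in group_hom) hom_commutator:
  "\<lbrakk>x \<in> carrier G; y \<in> carrier G\<rbrakk> \<Longrightarrow> h (commutator G x y) = commutator H (h x) (h y)"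
  by (simp add: commutator_def conjugate_def)

lemma (in subgroup) commutator_closed:
  "\<lbrakk>x \<in> H; y \<in> H; group G\<rbrakk> \<Longrightarrow> commutator G x y \<in> H"
  by (simp add: commutator_def conjugate_def)

text \<open>\<open>K\<close> will be the preimage of a generated subgroup, so it contains the kernel
  elements \<open>kq\<close>, \<open>kp\<close>, \<open>kr\<close>. It is filled from the top layer
  down: double commutators, then the simple commutator, then the generators, each giving everything
  up to a factor that is invertible modulo the kernel.\<close>

lemma subgroup_bch_group_eq_UNIV:
  fixes a b a' b' p q :: int
  defines "d \<equiv> a * b' - b * a'"
  assumes K: "subgroup K bch_group"
    and X: "(a, b, 0, 0, 0) \<in> K" and Y: "(a', b', 0, 0, 0) \<in> K"
    and kq: "\<And>i j. (q * i, q * j, 0, 0, 0) \<in> K"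
    and kp: "\<And>i. (0, 0, p * i, 0, 0) \<in> K"
    and kr: "\<And>i j. (0, 0, 0, p * i, p * j) \<in> K"
    and dp: "coprime (12 * d) p" and dq: "coprime d q"
  shows "K = UNIV"
proof -
  have mul: "bch_mult s t \<in> K" if "s \<in> K" "t \<in> K" for s t
    using subgroup.m_closed[OF K that] by simp
  have pow: "(n * a, n * b, n * k, n * x, n * y) \<in> K" if "(a, b, k, x, y) \<in> K" for n a b k x y
    using bch_group.subgroup_int_pow_closed[OF K that, of n] by simp
  have comm: "commutator bch_group s t \<in> K" if "s \<in> K" "t \<in> K" for s t
    using subgroup.commutator_closed[OF K that bch_group.group_axioms] .
  have U: "(0, 0, 0, x, y) \<in> K" for x y
  proof -
    have "coprime (12 * d * d) p" using dp by simp
    then obtain m where "[12 * d * d * m = 1] (mod p)" using cong_solve_coprime_int by blast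
    then have "[1 = 12 * d * d * m] (mod p)" by (rule cong_sym)
    then obtain n where n: "12 * d * d * m = 1 + p * n" by (auto simp: cong_iff_lin)
    \<comment> \<open>Cramer's rule: these coefficients combine \<open>(a, b)\<close> and
      \<open>(a', b')\<close> to \<open>m * d\<close> times \<open>(x, y)\<close>.\<close>
    define n1 n2 where "n1 = m * (x * b' - y * a')" and "n2 = m * (a * y - b * x)"
    have "(0, 0, 0, 12 * d * a, 12 * d * b) \<in> K" "(0, 0, 0, 12 * d * a', 12 * d * b') \<in> K"
      using comm[OF X comm[OF X Y]] comm[OF Y comm[OF X Y]]
      by (simp_all add: commutator_commutator_bch_group d_def Let_def)
    from mul[OF pow[OF this(1), of n1] pow[OF this(2), of n2]]
    have "(0, 0, 0, n1 * (12 * d * a) + n2 * (12 * d * a'), n1 * (12 * d * b) + n2 * (12 * d * b')) \<in> K"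
      by (simp add: Let_def)
    moreover have "n1 * (12 * d * a) + n2 * (12 * d * a') = (12 * d * d * m) * x"
      "n1 * (12 * d * b) + n2 * (12 * d * b') = (12 * d * d * m) * y"
      by (simp_all add: n1_def n2_def d_def algebra_simps)
    ultimately have "(0, 0, 0, (1 + p * n) * x, (1 + p * n) * y) \<in> K" by (simp add: n)
    from mul[OF this kr[of "- n * x" "- n * y"]] show ?thesis
      by (simp add: Let_def algebra_simps)
  qed
  have W: "(0, 0, k, 0, 0) \<in> K" for k
  proof -
    have "coprime (2 * d) p" using dp by auto
    then obtain m where "[2 * d * m = 1] (mod p)" using cong_solve_coprime_int by blast
    then have "[1 = 2 * d * m] (mod p)" by (rule cong_sym)
    then obtain n where n: "2 * d * m = 1 + p * n" by (auto simp: cong_iff_lin)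
    obtain x y where "(0, 0, 2 * d, x, y) \<in> K"
      using comm[OF X Y] by (auto simp: commutator_bch_group d_def Let_def)
    from mul[OF this U[of "- x" "- y"]] have "(0, 0, 2 * d, 0, 0) \<in> K" by (simp add: Let_def)
    from pow[OF this, of "m * k"] have "(0, 0, m * k * (2 * d), 0, 0) \<in> K" by (simp add: Let_def)
    also have "m * k * (2 * d) = (2 * d * m) * k" by (simp add: ac_simps)
    finally have "(0, 0, (1 + p * n) * k, 0, 0) \<in> K" by (simp add: n)
    from mul[OF this kp[of "- n * k"]] show ?thesis
      by (simp add: Let_def algebra_simps)
  qed
  have V: "(a, b, k', x', y') \<in> K" if t: "(a, b, k, x, y) \<in> K" for a b k x y k' x' y'
  proof -
    obtain u v where "(a, b, k', u, v) \<in> K"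
      using mul[OF t W[of "k' - k"]] by (auto simp: Let_def)
    from mul[OF this U[of "x' - u" "y' - v"]] show ?thesis by (simp add: Let_def)
  qed
  have "(x, y, k, x', y') \<in> K" for x y k x' y'
  proof -
    obtain m where "[d * m = 1] (mod q)" using cong_solve_coprime_int dq by blast
    then have "[1 = d * m] (mod q)" by (rule cong_sym)
    then obtain n where n: "d * m = 1 + q * n" by (auto simp: cong_iff_lin)
    define n1 n2 where "n1 = m * (x * b' - y * a')" and "n2 = m * (a * y - b * x)"
    obtain k' u v where "(n1 * a + n2 * a', n1 * b + n2 * b', k', u, v) \<in> K"
      using mul[OF pow[OF X, of n1] pow[OF Y, of n2]] by (auto simp: Let_def)
    moreover have "n1 * a + n2 * a' = (d * m) * x" "n1 * b + n2 * b' = (d * m) * y"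
      by (simp_all add: n1_def n2_def d_def algebra_simps)
    ultimately have "((1 + q * n) * x, (1 + q * n) * y, k', u, v) \<in> K" by (simp add: n)
    from mul[OF this kq[of "- n * x" "- n * y"]]
    obtain k' u v where "(x, y, k', u, v) \<in> K" by (auto simp: Let_def algebra_simps)
    then show ?thesis by (rule V)
  qed
  then show ?thesis by auto
qed

section \<open>Finite quotients\<close>

text \<open>
  The kernel of the quotient identifies the top layer \<open>u\<close> with \<open>p C u\<close>. The two cases of
  order \<open>p^5\<close> are \<open>q = p^2, r = 1\<close>, which gives \<open>G(12 C)\<close>, and \<open>q = r = p\<close> with \<open>C = 0\<close>, which gives
  the free class-3 group of exponent \<open>p\<close>. Since \<open>reduce\<close> is not idempotent, products in the
  quotient are computed on arbitrary preimages.
\<close>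

fun reduce :: "int \<Rightarrow> int \<Rightarrow> int \<Rightarrow> int4 \<Rightarrow> int5 \<Rightarrow> int5" where
  "reduce p q r (\<alpha>, \<beta>, \<gamma>, \<delta>) (a, b, k, x, y) =
     ((a + p * (\<alpha> * x + \<beta> * y)) mod q, (b + p * (\<gamma> * x + \<delta> * y)) mod q,
      k mod p, x mod r, y mod r)"

text \<open>Coding residues as natural numbers gives all quotients the one type
  \<open>nat monoid\<close>, so that they can be collected in a set.\<close>

definition residue :: "int \<Rightarrow> int \<Rightarrow> int \<Rightarrow> int4 \<Rightarrow> int5 \<Rightarrow> nat" where
  "residue p q r C t = to_nat (reduce p q r C t)"

definition bch_quotient :: "int \<Rightarrow> int \<Rightarrow> int \<Rightarrow> int4 \<Rightarrow> nat monoid" where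
  "bch_quotient p q r C = \<lparr>carrier = range (residue p q r C),
     monoid.mult = (\<lambda>m n. residue p q r C
       (bch_mult (inv_into UNIV (residue p q r C) m) (inv_into UNIV (residue p q r C) n))),
     one = residue p q r C (0, 0, 0, 0, 0)\<rparr>"

lemma residue_eq_iff:
  "residue p q r (\<alpha>, \<beta>, \<gamma>, \<delta>) (a, b, k, x, y) = residue p q r (\<alpha>, \<beta>, \<gamma>, \<delta>) (a', b', k', x', y') \<longleftrightarrow>
     [a + p * (\<alpha> * x + \<beta> * y) = a' + p * (\<alpha> * x' + \<beta> * y')] (mod q) \<and>
     [b + p * (\<gamma> * x + \<delta> * y) = b' + p * (\<gamma> * x' + \<delta> * y')] (mod q) \<and>
     [k = k'] (mod p) \<and> [x = x'] (mod r) \<and> [y = y'] (mod r)"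
  by (simp add: residue_def cong_def)

text \<open>The divisibility conditions allow the group laws and the Beauville structure to be
  treated at once for both cases of order \<open>p^5\<close>.\<close>

locale bch_params =
  fixes p q r :: int and C :: int4
  assumes prime_p: "Factorial_Ring.prime p" and p_gt_3: "p > 3"
    and p_dvd_q: "p dvd q" and q_dvd: "q dvd p\<^sup>2" and r_dvd: "r dvd p"
    and q_pos: "q > 0" and r_pos: "r > 0"
begin

abbreviation "e \<equiv> residue p q r C"
abbreviation "G \<equiv> bch_quotient p q r C"

lemma p_times_cong:
  assumes "[f = f'] (mod p)"
  shows "[p * f = p * f'] (mod q)"
proof -
  have "p\<^sup>2 dvd p * f - p * f'"
    using assms by (auto simp: cong_iff_dvd_diff power2_eq_square right_diff_distrib[symmetric])
  then show ?thesis
    using q_dvd by (auto simp: cong_iff_dvd_diff)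
qed

lemma cong_q_imp_p:
  assumes "[a + p * x = a' + p * x'] (mod q)"
  shows "[a = a'] (mod p)"
proof -
  have "p dvd (a + p * x) - (a' + p * x')"
    using assms p_dvd_q by (auto simp: cong_iff_dvd_diff)
  then have "p dvd ((a + p * x) - (a' + p * x')) - p * (x - x')"
    by (rule dvd_diff) simp
  then show ?thesis by (simp add: cong_iff_dvd_diff algebra_simps)
qed

text \<open>The residues determine \<open>a\<close>, \<open>b\<close>, \<open>k\<close> modulo
  \<open>p\<close>, hence also the bracket terms \<open>d\<close>, \<open>f\<close>,
  \<open>g\<close>. That precision is enough: \<open>f\<close> and \<open>g\<close> enter the first
  two coordinates with a factor \<open>p\<close>, and \<open>q\<close> divides \<open>p^2\<close>.
  The coordinates \<open>x\<close>, \<open>y\<close> enter only linearly, within sums already known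
  modulo \<open>q\<close>.\<close>

lemma residue_bch_mult_cong:
  assumes "e s = e s'" and "e t = e t'"
  shows "e (bch_mult s t) = e (bch_mult s' t')"
proof -
  obtain \<alpha> \<beta> \<gamma> \<delta> where C: "C = (\<alpha>, \<beta>, \<gamma>, \<delta>)" by (cases C)
  obtain a b k x y where s: "s = (a, b, k, x, y)" by (cases s)
  obtain a' b' k' x' y' where s': "s' = (a', b', k', x', y')" by (cases s')
  obtain a1 b1 k1 x1 y1 where t: "t = (a1, b1, k1, x1, y1)" by (cases t)
  obtain a1' b1' k1' x1' y1' where t': "t' = (a1', b1', k1', x1', y1')" by (cases t')
  have S: "[a + p * (\<alpha> * x + \<beta> * y) = a' + p * (\<alpha> * x' + \<beta> * y')] (mod q)"
     "[b + p * (\<gamma> * x + \<delta> * y) = b' + p * (\<gamma> * x' + \<delta> * y')] (mod q)"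
     "[k = k'] (mod p)" "[x = x'] (mod r)" "[y = y'] (mod r)"
    using assms(1) unfolding C s s' residue_eq_iff by auto
  have T: "[a1 + p * (\<alpha> * x1 + \<beta> * y1) = a1' + p * (\<alpha> * x1' + \<beta> * y1')] (mod q)"
     "[b1 + p * (\<gamma> * x1 + \<delta> * y1) = b1' + p * (\<gamma> * x1' + \<delta> * y1')] (mod q)"
     "[k1 = k1'] (mod p)" "[x1 = x1'] (mod r)" "[y1 = y1'] (mod r)"
    using assms(2) unfolding C t t' residue_eq_iff by auto
  note P = S(1,2)[THEN cong_q_imp_p] T(1,2)[THEN cong_q_imp_p]
  define d where "d = a * b1 - b * a1"
  define d' where "d' = a' * b1' - b' * a1'"
  define f where "f = 3 * (k1 * a - k * a1) + d * (a - a1)"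
  define f' where "f' = 3 * (k1' * a' - k' * a1') + d' * (a' - a1')"
  define g where "g = 3 * (k1 * b - k * b1) + d * (b - b1)"
  define g' where "g' = 3 * (k1' * b' - k' * b1') + d' * (b' - b1')"
  have d: "[d = d'] (mod p)"
    unfolding d_def d'_def by (intro cong_diff cong_mult P)
  have f: "[f = f'] (mod p)" and g: "[g = g'] (mod p)"
    unfolding f_def f'_def g_def g'_def
    by (intro cong_add cong_diff cong_mult P S(3) T(3) d cong_refl)+
  have fr: "[f = f'] (mod r)" and gr: "[g = g'] (mod r)"
    using f g r_dvd by (auto intro: cong_dvd_modulus)
  have A: "[p * (u * f + v * g) = p * (u * f' + v * g')] (mod q)" for u v
    by (intro p_times_cong cong_add cong_mult f g cong_refl)
  show ?thesis
    unfolding C s s' t t' bch_mult.simps Let_def d_def[symmetric] d'_def[symmetric] add.assoc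
    unfolding f_def[symmetric] f'_def[symmetric] g_def[symmetric] g'_def[symmetric] residue_eq_iff
  proof (intro conjI)
    show "[a + a1 + p * (\<alpha> * (x + (x1 + f)) + \<beta> * (y + (y1 + g))) =
           a' + a1' + p * (\<alpha> * (x' + (x1' + f')) + \<beta> * (y' + (y1' + g')))] (mod q)"
      using cong_add[OF cong_add[OF S(1) T(1)] A[of \<alpha> \<beta>]] by (simp add: algebra_simps)
    show "[b + b1 + p * (\<gamma> * (x + (x1 + f)) + \<delta> * (y + (y1 + g))) =
           b' + b1' + p * (\<gamma> * (x' + (x1' + f')) + \<delta> * (y' + (y1' + g')))] (mod q)"
      using cong_add[OF cong_add[OF S(2) T(2)] A[of \<gamma> \<delta>]] by (simp add: algebra_simps)
  qed (intro cong_add S T d fr gr)+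
qed

lemma residue_mult: "e s \<otimes>\<^bsub>G\<^esub> e t = e (bch_mult s t)"
  unfolding bch_quotient_def monoid.simps
  by (rule residue_bch_mult_cong) (simp_all add: f_inv_into_f)

lemma carrier_G: "carrier G = range e" and one_G: "\<one>\<^bsub>G\<^esub> = e (0, 0, 0, 0, 0)"
  by (simp_all add: bch_quotient_def)

lemma residue_hom: "e \<in> hom bch_group G"
  by (auto simp: hom_def residue_mult carrier_G)

lemma group_G: "group G"
proof -
  have "G\<lparr>carrier := e ` carrier bch_group, one := e \<one>\<^bsub>bch_group\<^esub>\<rparr> = G"
    by (simp add: bch_quotient_def)
  then show ?thesis using bch_group.hom_imp_img_group[OF residue_hom] by simp
qed

sublocale group_hom bch_group G e
  by (simp add: group_hom_def group_hom_axioms_def group_G residue_hom bch_group.group_axioms)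

lemma range_reduce: "range (reduce p q r C) = {0..<q} \<times> {0..<q} \<times> {0..<p} \<times> {0..<r} \<times> {0..<r}"
proof -
  obtain \<alpha> \<beta> \<gamma> \<delta> where C: "C = (\<alpha>, \<beta>, \<gamma>, \<delta>)" by (cases C)
  show ?thesis
  proof (intro equalityI subsetI)
    fix t assume "t \<in> range (reduce p q r C)"
    then obtain a b k x y where "t = reduce p q r C (a, b, k, x, y)" by auto
    then show "t \<in> {0..<q} \<times> {0..<q} \<times> {0..<p} \<times> {0..<r} \<times> {0..<r}"
      using q_pos r_pos p_gt_3 by (simp add: C)
  next
    fix t assume "t \<in> {0..<q} \<times> {0..<q} \<times> {0..<p} \<times> {0..<r} \<times> {0..<r}"
    then obtain a b k x y where t: "t = (a, b, k, x, y)" "a \<in> {0..<q}" "b \<in> {0..<q}"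
      "k \<in> {0..<p}" "x \<in> {0..<r}" "y \<in> {0..<r}" by blast
    \<comment> \<open>The preimage undoes the twist by \<open>C\<close> in the first two
      coordinates.\<close>
    then have "t = reduce p q r C (a - p * (\<alpha> * x + \<beta> * y), b - p * (\<gamma> * x + \<delta> * y), k, x, y)"
      by (simp add: C)
    then show "t \<in> range (reduce p q r C)" by (rule range_eqI)
  qed
qed

lemma finite_carrier: "finite (carrier G)"
proof -
  have "carrier G = to_nat ` range (reduce p q r C)"
    by (auto simp: carrier_G residue_def)
  then show ?thesis by (simp add: range_reduce)
qed

lemma order_G: "order G = nat (q * q * p * r * r)"
proof -
  have "carrier G = to_nat ` range (reduce p q r C)"
    by (auto simp: carrier_G residue_def)
  then have "order G = card (range (reduce p q r C))"
    by (simp add: order_def card_image inj_on_subset[OF inj_to_nat])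
  also have "\<dots> = nat (q * q * p * r * r)"
    using q_pos r_pos p_gt_3 by (simp add: range_reduce nat_mult_distrib)
  finally show ?thesis .
qed

section \<open>Generation and Beauville structures in the quotients\<close>

lemma coprime_q: "coprime d p \<Longrightarrow> coprime d q"
  using q_dvd by (metis coprime_divisors coprime_power_right_iff dvd_refl)

lemma residue_reduce: "e (a, b, p * k, p * x, p * y) = e (a, b, 0, 0, 0)"
proof -
  obtain \<alpha> \<beta> \<gamma> \<delta> where C: "C = (\<alpha>, \<beta>, \<gamma>, \<delta>)" by (cases C)
  have A: "[p * (u * (p * x) + v * (p * y)) = p * 0] (mod q)" for u v
    by (rule p_times_cong) (simp add: cong_iff_dvd_diff)
  have "[p * x = 0] (mod r)" for x
    using r_dvd by (simp add: cong_iff_dvd_diff)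
  then show ?thesis
    using cong_add[OF cong_refl[of a q] A] cong_add[OF cong_refl[of b q] A]
    unfolding C residue_eq_iff by (auto simp: cong_iff_dvd_diff)
qed

lemma residue_eq_one: "e (q * a, q * b, p * k, p * x, p * y) = \<one>\<^bsub>G\<^esub>"
proof -
  have "e (q * a, q * b, 0, 0, 0) = e (0, 0, 0, 0, 0)"
    by (cases C) (auto simp: residue_eq_iff cong_iff_dvd_diff)
  then show ?thesis by (simp add: residue_reduce one_G)
qed

lemma generate_residue:
  assumes "coprime (12 * (a * b' - b * a')) p"
  shows "generate G {e (a, b, 0, 0, 0), e (a', b', 0, 0, 0)} = carrier G"
proof -
  let ?H = "generate G {e (a, b, 0, 0, 0), e (a', b', 0, 0, 0)}"
  have H: "subgroup ?H G"
    by (rule H.generate_is_subgroup) (auto simp: carrier_G)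
  have one: "\<one>\<^bsub>G\<^esub> \<in> ?H" by (rule subgroup.one_closed[OF H])
  \<comment> \<open>Generation is checked upstairs, where the commutators are explicit
    polynomials.\<close>
  have "e -` ?H = UNIV"
  proof (rule subgroup_bch_group_eq_UNIV[where a = a and b = b and a' = a' and b' = b' and p = p and q = q])
    show "subgroup (e -` ?H) bch_group"
    proof (rule bch_group.subgroupI)
      fix s t assume "s \<in> e -` ?H" "t \<in> e -` ?H"
      then show "s \<otimes>\<^bsub>bch_group\<^esub> t \<in> e -` ?H" 
        using subgroup.m_closed[OF H, of "e s" "e t"] by (simp add: residue_mult)
    next
      fix s assume "s \<in> e -` ?H"
      then show "inv\<^bsub>bch_group\<^esub> s \<in> e -` ?H" 
        using subgroup.m_inv_closed[OF H, of "e s"] by simp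
    qed (use one in \<open>auto simp: one_G\<close>)
    show "(q * i, q * j, 0, 0, 0) \<in> e -` ?H" for i j
      using one residue_eq_one[of i j 0 0 0] by simp
    show "(0, 0, p * i, 0, 0) \<in> e -` ?H" for i
      using one residue_eq_one[of 0 0 i 0 0] by simp
    show "(0, 0, 0, p * i, p * j) \<in> e -` ?H" for i j
      using one residue_eq_one[of 0 0 0 i j] by simp
    show "coprime (a * b' - b * a') q"
      using assms unfolding coprime_mult_left_iff by (blast intro: coprime_q)
  qed (use assms in \<open>auto intro: generate.incl\<close>)
  then have "range e \<subseteq> ?H" by auto
  then show ?thesis
    using subgroup.subset[OF H] by (auto simp: carrier_G)
qed

text \<open>Independence of the two directions is used twice. Modulo \<open>p\<close> it forces
  \<open>p\<close> to divide both exponents; then both sides are multiples of \<open>p\<close> times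
  the two directions, and comparing them modulo \<open>q\<close> makes them vanish.\<close>

lemma conjugate_pow_eq_one:
  assumes d: "coprime (a * b' - b * a') p" 
    and eq: "e (conjugate bch_group ((a, b, k, x, y) [^]\<^bsub>bch_group\<^esub> (i::nat)) g) =
             e (conjugate bch_group ((a', b', k', x', y') [^]\<^bsub>bch_group\<^esub> (j::nat)) h)"
  shows "e (conjugate bch_group ((a, b, k, x, y) [^]\<^bsub>bch_group\<^esub> i) g) = \<one>\<^bsub>G\<^esub>"
proof -
  define d where "d = a * b' - b * a'"
  obtain \<alpha> \<beta> \<gamma> \<delta> where C: "C = (\<alpha>, \<beta>, \<gamma>, \<delta>)" by (cases C)
  obtain ga gb gk gx gy where g: "g = (ga, gb, gk, gx, gy)" by (cases g)
  obtain ha hb hk hx hy where h: "h = (ha, hb, hk, hx, hy)" by (cases h)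
  have ij: "[i * a = j * a'] (mod p)" "[i * b = j * b'] (mod p)"
    using eq unfolding C g h pow_bch_group conjugate_bch_group Let_def residue_eq_iff by (blast intro: cong_q_imp_p)+
  \<comment> \<open>Pairing with \<open>(b', -a')\<close> eliminates the second direction; the same
    is done modulo \<open>q\<close> further below.\<close>
  have "[i * a * b' - i * b * a' = j * a' * b' - j * b' * a'] (mod p)"
    using ij by (intro cong_diff cong_scalar_right)
  then have "p dvd i * d" by (simp add: cong_iff_dvd_diff d_def algebra_simps)
  then obtain m where m: "int i = p * m"
    using d by (auto simp: d_def coprime_dvd_mult_left_iff coprime_commute)
  have "[a * (i * b) - b * (i * a) = a * (j * b') - b * (j * a')] (mod p)"
    using ij by (intro cong_diff cong_scalar_left)
  then have "p dvd j * d" by (simp add: cong_iff_dvd_diff d_def algebra_simps dvd_diff_commute)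
  then obtain n where n: "int j = p * n"
    using d by (auto simp: d_def coprime_dvd_mult_left_iff coprime_commute)
  \<comment> \<open>If \<open>p\<close> divides the exponent, all corrections due to conjugation are
    multiples of \<open>p\<close> in the last three coordinates and disappear in the
    quotient.\<close>
  have conj_reduce: "e (conjugate bch_group ((a, b, k, x, y) [^]\<^bsub>bch_group\<^esub> i) g) = e (p * m * a, p * m * b, 0, 0, 0)"
    if "int i = p * m" for a b k x y i m g
  proof -
    obtain ga gb gk gx gy where g: "g = (ga, gb, gk, gx, gy)" by (cases g)
    define D where "D = a * gb - b * ga"
    have "conjugate bch_group ((a, b, k, x, y) [^]\<^bsub>bch_group\<^esub> i) g = (p * m * a, p * m * b, p * (m * k + 2 * m * D),
        p * (m * x + 6 * (gk * m * a - m * k * ga - m * D * ga)),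
        p * (m * y + 6 * (gk * m * b - m * k * gb - m * D * gb)))"
      by (simp add: g conjugate_bch_group that Let_def D_def algebra_simps)
    then show ?thesis by (simp add: residue_reduce)
  qed
  have "e (p * m * a, p * m * b, 0, 0, 0) = e (p * n * a', p * n * b', 0, 0, 0)"
    using eq unfolding conj_reduce[OF m] conj_reduce[OF n] .
  then have mn: "[p * m * a = p * n * a'] (mod q)" "[p * m * b = p * n * b'] (mod q)"
    by (auto simp: C residue_eq_iff)
  have "[p * m * a * b' - p * m * b * a' = p * n * a' * b' - p * n * b' * a'] (mod q)"
    using mn by (intro cong_diff cong_scalar_right)
  then have "q dvd p * m * d" by (simp add: cong_iff_dvd_diff d_def algebra_simps)
  then obtain c where c: "p * m = q * c"
    using coprime_q[of d] d coprime_dvd_mult_left_iff[of q d "p * m"]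
    by (auto simp: d_def coprime_commute)
  show ?thesis
    using residue_eq_one[of "c * a" "c * b" 0 0 0] unfolding conj_reduce[OF m] c by (simp add: mult.assoc)
qed

lemma beauville_Sigma_residue:
  assumes "z \<in> beauville_Sigma G (e s) (e t)"
  obtains w i g where "w \<in> {s, t, bch_mult s t}" "z = e (conjugate bch_group (w [^]\<^bsub>bch_group\<^esub> (i::nat)) g)"
proof -
  have "conjugate G (e w [^]\<^bsub>G\<^esub> i) (e g) = e (conjugate bch_group (w [^]\<^bsub>bch_group\<^esub> i) g)"
    for w g and i :: nat
    by (simp add: hom_conjugate local.hom_nat_pow)
  moreover from assms obtain i g' where "g' \<in> range e"
    and "z \<in> {conjugate G (e s [^]\<^bsub>G\<^esub> (i::nat)) g', conjugate G (e t [^]\<^bsub>G\<^esub> i) g',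
               conjugate G ((e s \<otimes>\<^bsub>G\<^esub> e t) [^]\<^bsub>G\<^esub> i) g'}"
    unfolding beauville_Sigma_def carrier_G by blast
  then obtain g w where "w \<in> {s, t, bch_mult s t}" "z = conjugate G (e w [^]\<^bsub>G\<^esub> i) (e g)"
    unfolding residue_mult by blast
  ultimately show thesis using that by metis
qed

lemma one_in_beauville_Sigma: "\<one>\<^bsub>G\<^esub> \<in> beauville_Sigma G (e s) (e t)"
proof -
  \<comment> \<open>The exponent \<open>order G\<close>, the last one in the index range, yields the
    identity.\<close>
  have "order G \<in> {1..order G}"
    using H.order_gt_0_iff_finite finite_carrier by auto
  moreover have "conjugate G (e s [^]\<^bsub>G\<^esub> order G) \<one>\<^bsub>G\<^esub> = \<one>\<^bsub>G\<^esub>"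
    by (simp add: conjugate_def H.pow_order_eq_1)
  ultimately show ?thesis
    unfolding beauville_Sigma_def by (intro UN_I[of "order G"] UN_I[OF H.one_closed]) simp_all
qed

lemma coprime_p: "coprime 2 p" "coprime 3 p"
proof -
  have "\<not> p dvd 2" "\<not> p dvd 3"
    using p_gt_3 zdvd_imp_le[of p 2] zdvd_imp_le[of p 3] by auto
  then show "coprime 2 p" "coprime 3 p"
    using prime_imp_coprime[OF prime_p] coprime_commute by blast+
qed

lemma beauville_G: "beauville_group G"
proof -
  let ?x1 = "(1, 0, 0, 0, 0)" and ?y1 = "(0, 1, 0, 0, 0)"
  let ?x2 = "(1, 2, 0, 0, 0)" and ?y2 = "(1, -1, 0, 0, 0)"
  \<comment> \<open>The generating pairs have determinants 1 and -3; times 12 this gives 12 and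
    -36.\<close>
  have "coprime (2 * 2 * 3) p" "coprime (2 * 2 * 3 * 3) p"
    using coprime_p by (simp_all only: coprime_mult_left_iff)
  then have c: "coprime 12 p" "coprime 36 p" by simp_all
  have "beauville_Sigma G (e ?x1) (e ?y1) \<inter> beauville_Sigma G (e ?x2) (e ?y2) \<subseteq> {\<one>\<^bsub>G\<^esub>}"
  proof clarify
    fix z assume "z \<in> beauville_Sigma G (e ?x1) (e ?y1)" "z \<in> beauville_Sigma G (e ?x2) (e ?y2)"
    then obtain s i g t j h where s: "s \<in> {?x1, ?y1, bch_mult ?x1 ?y1}" and t: "t \<in> {?x2, ?y2, bch_mult ?x2 ?y2}"
      and z: "z = e (conjugate bch_group (s [^]\<^bsub>bch_group\<^esub> (i::nat)) g)" "z = e (conjugate bch_group (t [^]\<^bsub>bch_group\<^esub> (j::nat)) h)"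
      by (metis beauville_Sigma_residue)
    obtain a b k x y where s': "s = (a, b, k, x, y)" by (cases s)
    obtain a' b' k' x' y' where t': "t = (a', b', k', x', y')" by (cases t)
    \<comment> \<open>All nine determinants of a direction of the first triple against one of the
      second are 1, -1, 2 or -2.\<close>
    have "coprime (a * b' - b * a') p"
      using s t coprime_p(1) unfolding s' t' by (auto simp: Let_def)
    from conjugate_pow_eq_one[OF this] show "z = \<one>\<^bsub>G\<^esub>"
      using z unfolding s' t' by metis
  qed
  then have "beauville_structure G (e ?x1, e ?y1) (e ?x2, e ?y2)"
    unfolding beauville_structure_def
    using one_in_beauville_Sigma c by (auto simp: generate_residue)
  then show ?thesis
    unfolding beauville_group_def using group_G finite_carrier by blast
qed

end

section \<open>Isomorphisms between the quotients\<close>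

lemma bch_params_square:
  assumes "Factorial_Ring.prime p" and "p > 3"
  shows "bch_params p (p\<^sup>2) 1"
  using assms by (simp add: bch_params_def power2_eq_square)

text \<open>Let \<open>P\<close> have columns \<open>(a, b)\<close> and \<open>(a', b')\<close>, the
  images of the generators modulo \<open>p\<close>. The congruences are the entries of
  \<open>P C = d C' P\<close>; each column arises by computing the image of one double commutator in
  two ways.\<close>

lemma bch_quotient_iso_imp_matrix_relation:
  fixes p :: int
  assumes p: "Factorial_Ring.prime p" "p > 3"
    and iso: "bch_quotient p (p\<^sup>2) 1 (\<alpha>, \<beta>, \<gamma>, \<delta>) \<cong> bch_quotient p (p\<^sup>2) 1 (\<alpha>', \<beta>', \<gamma>', \<delta>')"
  obtains a b a' b' d where "d = a * b' - b * a'" and "\<not> p dvd d"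
    and "[\<alpha> * a + \<gamma> * a' = d * (\<alpha>' * a + \<beta>' * b)] (mod p)"
    and "[\<alpha> * b + \<gamma> * b' = d * (\<gamma>' * a + \<delta>' * b)] (mod p)"
    and "[\<beta> * a + \<delta> * a' = d * (\<alpha>' * a' + \<beta>' * b')] (mod p)"
    and "[\<beta> * b + \<delta> * b' = d * (\<gamma>' * a' + \<delta>' * b')] (mod p)"
proof -
  interpret G: bch_params p "p\<^sup>2" 1 "(\<alpha>, \<beta>, \<gamma>, \<delta>)"
    using p by (rule bch_params_square)
  interpret H: bch_params p "p\<^sup>2" 1 "(\<alpha>', \<beta>', \<gamma>', \<delta>')"
    using p by (rule bch_params_square)
  obtain \<phi> where \<phi>: "\<phi> \<in> hom G.G H.G" "inj_on \<phi> (carrier G.G)"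
    using iso by (auto simp: is_iso_def iso_def bij_betw_def)
  define \<psi> where "\<psi> = \<phi> \<circ> G.e"
  have "\<psi> \<in> hom bch_group H.G"
    unfolding \<psi>_def using G.residue_hom \<phi>(1) by (rule hom_compose)
  then interpret psi: group_hom bch_group H.G \<psi>
    by (simp add: group_hom_def group_hom_axioms_def H.group_G bch_group.group_axioms)
  have \<psi>_eq: "\<psi> u = \<psi> v \<longleftrightarrow> G.e u = G.e v" for u v
    using inj_on_eq_iff[OF \<phi>(2), of "G.e u" "G.e v"] by (simp add: \<psi>_def G.carrier_G)
  have range: "\<psi> u \<in> range H.e" for u
    using psi.hom_closed[of u] by (simp add: H.carrier_G)
  obtain s where s: "\<psi> (1, 0, 0, 0, 0) = H.e s" using range by (rule rangeE)
  obtain t where t: "\<psi> (0, 1, 0, 0, 0) = H.e t" using range by (rule rangeE)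
  obtain a b k x y where s': "s = (a, b, k, x, y)" by (cases s)
  obtain a' b' k' x' y' where t': "t = (a', b', k', x', y')" by (cases t)
  define d where "d = a * b' - b * a'"
  have comm: "\<psi> (commutator bch_group u v) = H.e (commutator bch_group w z)"
    if "\<psi> u = H.e w" "\<psi> v = H.e z" for u v w z
    using that by (simp add: psi.hom_commutator H.hom_commutator)
  \<comment> \<open>On multiples of \<open>p\<close> the map acts linearly through \<open>P\<close>:
    the bracket terms of the products lie in the part that \<open>residue_reduce\<close>
    removes.\<close>
  have lin: "\<psi> (p * m, p * n, 0, 0, 0) = H.e (p * (m * a + n * a'), p * (m * b + n * b'), 0, 0, 0)" for m n
  proof -
    have "\<psi> (bch_mult ((1, 0, 0, 0, 0) [^]\<^bsub>bch_group\<^esub> (p * m)) ((0, 1, 0, 0, 0) [^]\<^bsub>bch_group\<^esub> (p * n)))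
      = H.e (bch_mult (s [^]\<^bsub>bch_group\<^esub> (p * m)) (t [^]\<^bsub>bch_group\<^esub> (p * n)))"
      using psi.hom_mult[of "(1, 0, 0, 0, 0) [^]\<^bsub>bch_group\<^esub> (p * m)" "(0, 1, 0, 0, 0) [^]\<^bsub>bch_group\<^esub> (p * n)"]
        H.hom_mult[of "s [^]\<^bsub>bch_group\<^esub> (p * m)" "t [^]\<^bsub>bch_group\<^esub> (p * n)"]
      by (simp add: psi.hom_int_pow H.hom_int_pow s t del: int_pow_bch_group)
    moreover have "bch_mult ((1, 0, 0, 0, 0) [^]\<^bsub>bch_group\<^esub> (p * m)) ((0, 1, 0, 0, 0) [^]\<^bsub>bch_group\<^esub> (p * n)) =
        (p * m, p * n, p * (m * (p * n)), p * (p * m * m * (p * n)), p * (- m * (p * n) * (p * n)))"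
      by (simp add: Let_def algebra_simps)
    moreover have "\<exists>u v w. bch_mult (s [^]\<^bsub>bch_group\<^esub> (p * m)) (t [^]\<^bsub>bch_group\<^esub> (p * n)) =
      (p * (m * a + n * a'), p * (m * b + n * b'), p * u, p * v, p * w)"
    proof -
      define D where "D = m * a * (p * n * b') - m * b * (p * n * a')"
      show ?thesis
        unfolding s' t'
        by (rule exI[of _ "m * k + n * k' + D"],
            rule exI[of _ "m * x + n * x' + 3 * (p * n * k' * m * a - m * k * p * n * a') + D * (p * m * a - p * n * a')"],
            rule exI[of _ "m * y + n * y' + 3 * (p * n * k' * m * b - m * k * p * n * b') + D * (p * m * b - p * n * b')"])
          (simp add: Let_def D_def algebra_simps)
    qed
    moreover have "\<psi> (p * m, p * n, p * u, p * v, p * w) = \<psi> (p * m, p * n, 0, 0, 0)" for u v w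
      unfolding \<psi>_eq by (rule G.residue_reduce)
    ultimately show ?thesis using H.residue_reduce by metis
  qed
  \<comment> \<open>If \<open>P\<close> were singular modulo \<open>p\<close>, its adjugate would
    supply kernel vectors. Injectivity then makes all entries of \<open>P\<close> divisible by
    \<open>p\<close>, so that even the \<open>p\<close>-th power of the first generator would be
    lost.\<close>
  have nz: "\<not> p dvd d"
  proof
    assume d: "p dvd d"
    have "H.e (0, 0, 0, 0, 0) = \<psi> (0, 0, 0, 0, 0)"
      using psi.hom_one H.one_G by simp
    have zero: "p dvd m \<and> p dvd n" if "p dvd m * a + n * a'" "p dvd m * b + n * b'" for m n
    proof -
      have "\<psi> (p * m, p * n, 0, 0, 0) = H.e (0, 0, 0, 0, 0)"
        using that unfolding lin by (auto simp: residue_eq_iff cong_iff_dvd_diff power2_eq_square)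
      also have "\<dots> = \<psi> (0, 0, 0, 0, 0)" by fact
      finally show ?thesis
        using p by (auto simp: \<psi>_eq residue_eq_iff cong_iff_dvd_diff power2_eq_square)
    qed
    have "p dvd a" "p dvd a'" using zero[of a' "-a"] d by (auto simp: d_def algebra_simps)
    moreover have "p dvd b" "p dvd b'" using zero[of b' "-b"] d by (auto simp: d_def algebra_simps)
    ultimately have "p dvd 1" using zero[of 1 0] by auto
    then show False using p by auto
  qed
  have cancel: "[u = v] (mod p)" if "[p * (12 * u) = p * (12 * v)] (mod p\<^sup>2)" for u v
  proof -
    have "p * p dvd p * (12 * (u - v))"
      using that by (simp add: cong_iff_dvd_diff power2_eq_square algebra_simps)
    then have "p dvd 2 * 2 * 3 * (u - v)" using p by simp
    moreover have "coprime (2 * 2 * 3) p"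
      using G.coprime_p by (simp only: coprime_mult_left_iff)
    ultimately show ?thesis
      by (simp only: coprime_dvd_mult_right_iff coprime_commute cong_iff_dvd_diff)
  qed
  have "\<psi> (0, 0, 0, 12, 0) = H.e (0, 0, 0, 12 * d * a, 12 * d * b)"
    using comm[OF s comm[OF s t]] by (simp add: commutator_commutator_bch_group s' t' d_def Let_def)
  \<comment> \<open>In the source the quotient identifies the top layer \<open>u\<close> with
    \<open>p C u\<close>, so the double commutator is also a multiple of \<open>p\<close>, to which
    \<open>lin\<close> applies.\<close>
  moreover have "\<psi> (0, 0, 0, 12, 0) = \<psi> (p * (12 * \<alpha>), p * (12 * \<gamma>), 0, 0, 0)"
    by (simp add: \<psi>_eq residue_eq_iff algebra_simps)
  ultimately have "H.e (p * (12 * \<alpha> * a + 12 * \<gamma> * a'), p * (12 * \<alpha> * b + 12 * \<gamma> * b'), 0, 0, 0) =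
      H.e (0, 0, 0, 12 * d * a, 12 * d * b)"
    using lin by simp
  then have 1: "[\<alpha> * a + \<gamma> * a' = d * (\<alpha>' * a + \<beta>' * b)] (mod p)"
    "[\<alpha> * b + \<gamma> * b' = d * (\<gamma>' * a + \<delta>' * b)] (mod p)"
    by (auto intro!: cancel simp: residue_eq_iff algebra_simps)
  have "\<psi> (0, 0, 0, 0, 12) = H.e (0, 0, 0, 12 * d * a', 12 * d * b')"
    using comm[OF t comm[OF s t]] by (simp add: commutator_commutator_bch_group s' t' d_def Let_def)
  moreover have "\<psi> (0, 0, 0, 0, 12) = \<psi> (p * (12 * \<beta>), p * (12 * \<delta>), 0, 0, 0)"
    by (simp add: \<psi>_eq residue_eq_iff algebra_simps)
  ultimately have "H.e (p * (12 * \<beta> * a + 12 * \<delta> * a'), p * (12 * \<beta> * b + 12 * \<delta> * b'), 0, 0, 0) =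
      H.e (0, 0, 0, 12 * d * a', 12 * d * b')"
    using lin by simp
  then have 2: "[\<beta> * a + \<delta> * a' = d * (\<alpha>' * a' + \<beta>' * b')] (mod p)"
    "[\<beta> * b + \<delta> * b' = d * (\<gamma>' * a' + \<delta>' * b')] (mod p)"
    by (auto intro!: cancel simp: residue_eq_iff algebra_simps)
  show thesis by (rule that[OF d_def nz 1 2])
qed

text \<open>On the left all \<open>p\<close>-th powers are trivial; on the right the first generator
  has the \<open>p\<close>-th power \<open>(p, 0, 0, 0, 0)\<close>, nonzero modulo
  \<open>p^2\<close>.\<close>

lemma bch_quotient_not_iso_exponent_p:
  fixes p :: int
  assumes p: "Factorial_Ring.prime p" "p > 3"
  shows "\<not> bch_quotient p p p (0, 0, 0, 0) \<cong> bch_quotient p (p\<^sup>2) 1 C"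
proof
  assume "bch_quotient p p p (0, 0, 0, 0) \<cong> bch_quotient p (p\<^sup>2) 1 C"
  then obtain \<phi> where \<phi>: "\<phi> \<in> hom (bch_quotient p p p (0, 0, 0, 0)) (bch_quotient p (p\<^sup>2) 1 C)"
    and surj: "\<phi> ` carrier (bch_quotient p p p (0, 0, 0, 0)) = carrier (bch_quotient p (p\<^sup>2) 1 C)"
    by (auto simp: is_iso_def iso_def bij_betw_def)
  interpret G: bch_params p p p "(0, 0, 0, 0)"
    using p by (simp add: bch_params_def power2_eq_square)
  interpret H: bch_params p "p\<^sup>2" 1 C
    using p by (rule bch_params_square)
  interpret phi: group_hom G.G H.G \<phi>
    by (simp add: group_hom_def group_hom_axioms_def H.group_G G.group_G \<phi>)
  have "H.e (1, 0, 0, 0, 0) \<in> \<phi> ` range G.e"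
    using surj unfolding G.carrier_G H.carrier_G by simp
  then obtain s where s: "H.e (1, 0, 0, 0, 0) = \<phi> (G.e s)" by blast
  have "H.e ((1, 0, 0, 0, 0) [^]\<^bsub>bch_group\<^esub> p) = \<phi> (G.e (s [^]\<^bsub>bch_group\<^esub> p))"
    by (simp add: G.hom_int_pow H.hom_int_pow phi.hom_int_pow s G.carrier_G del: int_pow_bch_group)
  also have "G.e (s [^]\<^bsub>bch_group\<^esub> p) = \<one>\<^bsub>G.G\<^esub>"
  proof -
    obtain a b k x y where "s = (a, b, k, x, y)" by (cases s)
    then show ?thesis using G.residue_eq_one[of a b k x y] by simp
  qed
  finally have "H.e (p, 0, 0, 0, 0) = H.e (0, 0, 0, 0, 0)"
    by (simp add: H.one_G)
  then have "p\<^sup>2 dvd p"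
    by (cases C) (simp add: residue_eq_iff cong_iff_dvd_diff)
  then show False using p by (auto simp: power2_eq_square)
qed

lemma trace_det_of_matrix_relation:
  fixes d p :: int
  assumes p: "Factorial_Ring.prime p" and d: "d = a * b' - b * a'" and nz: "\<not> p dvd d"
    and R: "[\<alpha> * a + \<gamma> * a' = d * (\<alpha>' * a + \<beta>' * b)] (mod p)"
      "[\<alpha> * b + \<gamma> * b' = d * (\<gamma>' * a + \<delta>' * b)] (mod p)"
      "[\<beta> * a + \<delta> * a' = d * (\<alpha>' * a' + \<beta>' * b')] (mod p)"
      "[\<beta> * b + \<delta> * b' = d * (\<gamma>' * a' + \<delta>' * b')] (mod p)"
  shows "[\<alpha> + \<delta> = d * (\<alpha>' + \<delta>')] (mod p)"
    and "[\<alpha> * \<delta> - \<beta> * \<gamma> = d\<^sup>2 * (\<alpha>' * \<delta>' - \<beta>' * \<gamma>')] (mod p)"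
proof -
  have cop: "coprime d p"
    using prime_imp_coprime[OF p nz] by (simp add: coprime_commute)
  \<comment> \<open>This is the trace of \<open>P C = d C' P\<close> after multiplication by the
    adjugate of \<open>P\<close>. The second claim takes determinants of both sides. Either way one
    factor \<open>d\<close> cancels.\<close>
  have "[b' * (\<alpha> * a + \<gamma> * a') - a' * (\<alpha> * b + \<gamma> * b') - b * (\<beta> * a + \<delta> * a') + a * (\<beta> * b + \<delta> * b')
    = b' * (d * (\<alpha>' * a + \<beta>' * b)) - a' * (d * (\<gamma>' * a + \<delta>' * b)) - b * (d * (\<alpha>' * a' + \<beta>' * b'))
      + a * (d * (\<gamma>' * a' + \<delta>' * b'))] (mod p)"
    using R by (intro cong_add cong_diff cong_scalar_left)
  also have "b' * (\<alpha> * a + \<gamma> * a') - a' * (\<alpha> * b + \<gamma> * b') - b * (\<beta> * a + \<delta> * a') + a * (\<beta> * b + \<delta> * b')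
    = d * (\<alpha> + \<delta>)" by (simp add: d algebra_simps)
  also have "b' * (d * (\<alpha>' * a + \<beta>' * b)) - a' * (d * (\<gamma>' * a + \<delta>' * b)) - b * (d * (\<alpha>' * a' + \<beta>' * b'))
      + a * (d * (\<gamma>' * a' + \<delta>' * b')) = d * (d * (\<alpha>' + \<delta>'))" by (simp add: d algebra_simps)
  finally show "[\<alpha> + \<delta> = d * (\<alpha>' + \<delta>')] (mod p)"
    using cop by (simp add: cong_mult_lcancel)
  have "[(\<alpha> * a + \<gamma> * a') * (\<beta> * b + \<delta> * b') - (\<beta> * a + \<delta> * a') * (\<alpha> * b + \<gamma> * b')
    = d * (\<alpha>' * a + \<beta>' * b) * (d * (\<gamma>' * a' + \<delta>' * b'))
      - d * (\<alpha>' * a' + \<beta>' * b') * (d * (\<gamma>' * a + \<delta>' * b))] (mod p)"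
    using R by (intro cong_diff cong_mult)
  also have "(\<alpha> * a + \<gamma> * a') * (\<beta> * b + \<delta> * b') - (\<beta> * a + \<delta> * a') * (\<alpha> * b + \<gamma> * b')
    = d * (\<alpha> * \<delta> - \<beta> * \<gamma>)" by (simp add: d algebra_simps)
  also have "d * (\<alpha>' * a + \<beta>' * b) * (d * (\<gamma>' * a' + \<delta>' * b'))
      - d * (\<alpha>' * a' + \<beta>' * b') * (d * (\<gamma>' * a + \<delta>' * b)) =
      d * (d\<^sup>2 * (\<alpha>' * \<delta>' - \<beta>' * \<gamma>'))" by (simp add: d algebra_simps power2_eq_square)
  finally show "[\<alpha> * \<delta> - \<beta> * \<gamma> = d\<^sup>2 * (\<alpha>' * \<delta>' - \<beta>' * \<gamma>')] (mod p)"
    using cop by (simp add: cong_mult_lcancel)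
qed

section \<open>Pairwise inequivalent matrices\<close>

text \<open>Squaring identifies 1 and \<open>p - 1\<close>, so on the finite set of residues it is
  not injective and hence not surjective.\<close>

lemma exists_nonsquare_mod:
  fixes p :: int
  assumes "p > 2"
  obtains \<nu> where "\<nu> \<in> {1<..<p}" and "\<And>x. \<not> [x\<^sup>2 = \<nu>] (mod p)"
proof -
  let ?f = "\<lambda>x. x\<^sup>2 mod p"
  have "(p - 1)\<^sup>2 = 1 + (p - 2) * p" by (simp add: power2_eq_square algebra_simps)
  then have "?f (p - 1) = ?f 1" by simp
  moreover have "p - 1 \<in> {0..<p}" "1 \<in> {0..<p}" "p - 1 \<noteq> 1" using assms by auto
  ultimately have "\<not> inj_on ?f {0..<p}" unfolding inj_on_def by blast
  then have "\<not> {0..<p} \<subseteq> ?f ` {0..<p}"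
    using endo_inj_surj finite_surj_inj by blast
  then obtain \<nu> where \<nu>: "\<nu> \<in> {0..<p}" "\<nu> \<notin> ?f ` {0..<p}" by blast
  have "\<not> [x\<^sup>2 = \<nu>] (mod p)" for x
  proof
    assume "[x\<^sup>2 = \<nu>] (mod p)"
    then have "\<nu> = ?f (x mod p)" using \<nu>(1) by (simp add: cong_def power_mod)
    then show False using \<nu>(2) assms by auto
  qed
  moreover from this[of 0] this[of 1] \<nu>(1) have "\<nu> \<in> {1<..<p}"
    by (cases "\<nu> = 0 \<or> \<nu> = 1") auto
  ultimately show thesis using that by blast
qed

text \<open>
  The four families are told apart by which of trace, determinant and discriminant vanish
  modulo \<open>p\<close>. Trace and determinant of a companion matrix below both equal \<open>t\<close>; the value 4 is
  left out because there the discriminant \<open>t (t - 4)\<close> vanishes.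
\<close>

definition jordan_matrices :: "int \<Rightarrow> int4 set" where
  "jordan_matrices \<nu> = (\<lambda>(l, n). (l, n, 0, l)) ` ({0, 1} \<times> {0, 1, \<nu>})"

definition companion_matrices :: "int \<Rightarrow> int4 set" where
  "companion_matrices p = (\<lambda>t. (0, - t, 1, t)) ` ({1..<p} - {4})"

definition matrices :: "int \<Rightarrow> int \<Rightarrow> int4 set" where
  "matrices p \<nu> = jordan_matrices \<nu> \<union> companion_matrices p \<union> {(0, 1, 1, 0), (0, \<nu>, 1, 0)} \<union> {(1, 0, 0, 0)}"

text \<open>The families contribute 6, \<open>p - 2\<close>, 2 and 1 matrices; \<open>p > 4\<close>
  ensures that the omitted value 4 lies in the range.\<close>

lemma card_matrices:
  assumes "\<nu> > 1" and "p > 4"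
  shows "finite (matrices p \<nu>)" and "card (matrices p \<nu>) = nat p + 7"
proof -
  have "inj_on (\<lambda>(l, n). (l, n, 0, l) :: int4) A" for A
    by (rule inj_onI) auto
  then have "card (jordan_matrices \<nu>) = card ({0, 1} \<times> {0, 1, \<nu>} :: (int \<times> int) set)"
    unfolding jordan_matrices_def by (rule card_image)
  also have "\<dots> = card {0, 1 :: int} * card {0, 1, \<nu>}"
    by (rule card_cartesian_product)
  also have "card {0, 1, \<nu>} = 3" using assms by auto
  finally have J: "finite (jordan_matrices \<nu>)" "card (jordan_matrices \<nu>) = 6"
    by (auto simp: jordan_matrices_def)
  have "card (companion_matrices p) = card ({1..<p} - {4})"
    unfolding companion_matrices_def by (rule card_image) (auto intro: inj_onI)
  also have "\<dots> = nat p - 2" using assms by (simp add: nat_diff_distrib)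
  finally have T: "finite (companion_matrices p)" "card (companion_matrices p) = nat p - 2"
    by (auto simp: companion_matrices_def)
  have J': "\<exists>l n. M = (l, n, 0, l)" if "M \<in> jordan_matrices \<nu>" for M
    using that unfolding jordan_matrices_def by auto
  have T': "\<exists>t. M = (0, - t, 1, t) \<and> t \<noteq> 0" if "M \<in> companion_matrices p" for M
  proof -
    from that obtain t where "M = (0, - t, 1, t)" "t \<in> {1..<p} - {4}"
      unfolding companion_matrices_def by blast
    then show ?thesis by (intro exI[of _ t]) simp
  qed
  have "jordan_matrices \<nu> \<inter> companion_matrices p = {}"
    "(jordan_matrices \<nu> \<union> companion_matrices p) \<inter> {(0, 1, 1, 0), (0, \<nu>, 1, 0)} = {}"
    "(jordan_matrices \<nu> \<union> companion_matrices p \<union> {(0, 1, 1, 0), (0, \<nu>, 1, 0)}) \<inter> {(1, 0, 0, 0)} = {}"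
    by (auto dest!: J' T')
  with J T assms show "finite (matrices p \<nu>)" "card (matrices p \<nu>) = nat p + 7"
    unfolding matrices_def by (simp_all add: card_Un_disjoint)
qed

lemma matrices_cases:
  assumes "M \<in> matrices p \<nu>"
  obtains (jordan) l n where "M = (l, n, 0, l)" "l \<in> {0, 1}" "n \<in> {0, 1, \<nu>}"
  | (companion) t where "M = (0, - t, 1, t)" "t \<in> {1..<p}" "t \<noteq> 4"
  | (traceless) m where "M = (0, m, 1, 0)" "m \<in> {1, \<nu>}"
  | (singular) "M = (1, 0, 0, 0)"
proof -
  from assms consider "M \<in> jordan_matrices \<nu>" | "M \<in> companion_matrices p"
    | m where "M = (0, m, 1, 0)" "m \<in> {1, \<nu>}" | "M = (1, 0, 0, 0)"
    unfolding matrices_def by blast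
  then show thesis
  proof cases
    case 1
    then obtain l n where "M = (l, n, 0, l)" "l \<in> {0, 1}" "n \<in> {0, 1, \<nu>}"
      unfolding jordan_matrices_def by auto
    then show thesis by (rule jordan)
  next
    case 2
    then obtain t where "M = (0, - t, 1, t)" "t \<in> {1..<p} - {4}"
      unfolding companion_matrices_def by blast
    then show thesis using companion by blast
  qed (rule traceless singular; assumption)+
qed

text \<open>The vanishing pattern puts \<open>M\<close> and \<open>M'\<close> in the same family.
  Trace and determinant then settle the companion and traceless families. They do not see the
  off-diagonal entry of a Jordan matrix, for which the full relation is needed.\<close>

lemma matrices_relation_imp_eq:
  fixes p :: int
  assumes p: "Factorial_Ring.prime p" "p > 3"
    and \<nu>: "\<nu> \<in> {1<..<p}" "\<And>x. \<not> [x\<^sup>2 = \<nu>] (mod p)"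
    and M: "M \<in> matrices p \<nu>" "M' \<in> matrices p \<nu>"
    and C: "M = (\<alpha>, \<beta>, \<gamma>, \<delta>)" "M' = (\<alpha>', \<beta>', \<gamma>', \<delta>')"
    and d: "d = a * b' - b * a'" and nz: "\<not> p dvd d"
    and R: "[\<alpha> * a + \<gamma> * a' = d * (\<alpha>' * a + \<beta>' * b)] (mod p)"
      "[\<alpha> * b + \<gamma> * b' = d * (\<gamma>' * a + \<delta>' * b)] (mod p)"
      "[\<beta> * a + \<delta> * a' = d * (\<alpha>' * a' + \<beta>' * b')] (mod p)"
      "[\<beta> * b + \<delta> * b' = d * (\<gamma>' * a' + \<delta>' * b')] (mod p)"
  shows "M = M'"
proof -
  define tr where "tr = (\<lambda>(\<alpha>, \<beta> :: int, \<gamma> :: int, \<delta>). \<alpha> + \<delta> :: int)"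
  define det where "det = (\<lambda>(\<alpha>, \<beta>, \<gamma>, \<delta>). \<alpha> * \<delta> - \<beta> * \<gamma> :: int)"
  define disc where "disc M = (tr M)\<^sup>2 - 4 * det M" for M
  have tr: "[tr M = d * tr M'] (mod p)" and det: "[det M = d\<^sup>2 * det M'] (mod p)"
    using trace_det_of_matrix_relation[OF p(1) d nz R] by (simp_all add: tr_def det_def C)
  have disc: "[disc M = d\<^sup>2 * disc M'] (mod p)"
    using cong_diff[OF cong_pow[OF tr, of 2] cong_scalar_left[OF det, of 4]]
    by (simp add: disc_def power_mult_distrib algebra_simps)
  have pd: "p dvd x * y \<longleftrightarrow> p dvd x \<or> p dvd y" for x y
    using p(1) by (rule prime_dvd_mult_iff)
  have zero: "p dvd tr M \<longleftrightarrow> p dvd tr M'" "p dvd det M \<longleftrightarrow> p dvd det M'" "p dvd disc M \<longleftrightarrow> p dvd disc M'"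
    using cong_dvd_iff[OF tr] cong_dvd_iff[OF det] cong_dvd_iff[OF disc] nz
    by (auto simp: pd power2_eq_square)
  have small: "\<not> p dvd x" if "x \<in> {1..<p}" for x
    using that zdvd_not_zless by auto
  have small_eq: "x = y" if "[x = y] (mod p)" "x \<in> {1..<p}" "y \<in> {1..<p}" for x y
    using that by (simp add: cong_def)
  have p2: "\<not> p dvd 2" "\<not> p dvd 4" "\<not> p dvd 1"
    using small[of 2] small[of 1] pd[of 2 2] p(2) by auto
  \<comment> \<open>If \<open>1 = x^2 * \<nu>\<close>, then \<open>\<nu> = (x * \<nu>)^2\<close>
    would be a square.\<close>
  have nonsq: "m = m'" if "[m = x\<^sup>2 * m'] (mod p)" "m \<in> {1, \<nu>}" "m' \<in> {1, \<nu>}" for m m' x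
  proof -
    consider "m = m'" | "m = \<nu>" "m' = 1" | "m = 1" "m' = \<nu>" using \<open>m \<in> _\<close> \<open>m' \<in> _\<close> by blast
    then show ?thesis
    proof cases
      case 2
      then show ?thesis using \<open>[m = _] (mod p)\<close> \<nu>(2)[of x] by (auto dest: cong_sym)
    next
      case 3
      then have "[\<nu> * 1 = \<nu> * (x\<^sup>2 * \<nu>)] (mod p)"
        using \<open>[m = _] (mod p)\<close> by (intro cong_scalar_left) simp
      then have "[(x * \<nu>)\<^sup>2 = \<nu>] (mod p)"
        by (simp add: power2_eq_square ac_simps cong_sym_eq)
      then show ?thesis using \<nu>(2) by blast
    qed
  qed
  have disc_nz: "\<not> p dvd disc N" if "N \<in> matrices p \<nu>" "\<And>l n. N \<noteq> (l, n, 0, l)" for N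
    using that(1)
  proof (cases rule: matrices_cases)
    case (jordan l n)
    then show ?thesis using that(2) by blast
  next
    case (companion t)
    have "\<not> p dvd t - 4"
    proof
      assume "p dvd t - 4"
      then have "[t = 4] (mod p)" by (simp add: cong_iff_dvd_diff)
      moreover have "p \<noteq> 4" using p2(2) by auto
      ultimately show False using small_eq[of t 4] companion p by simp
    qed
    moreover have "disc N = t * (t - 4)"
      by (simp add: companion disc_def tr_def det_def power2_eq_square algebra_simps)
    ultimately show ?thesis using small[of t] companion by (simp add: pd)
  next
    case (traceless m)
    then have "disc N = 4 * m" by (simp add: disc_def tr_def det_def)
    then show ?thesis using traceless small[of m] \<nu>(1) p2 by (auto simp: pd)
  next
    case singular
    then show ?thesis using p2 by (simp add: disc_def tr_def det_def)
  qed
  have disc_z: "p dvd disc (l, n, 0, l)" for l n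
    by (simp add: disc_def tr_def det_def power2_eq_square)
  show ?thesis
    using M(1)
  proof (cases rule: matrices_cases)
    case J: (jordan l n)
    then have "p dvd disc M'" using zero(3) disc_z by simp
    then obtain l' n' where "M' = (l', n', 0, l')" using disc_nz[OF M(2)] by blast
    then have J': "M' = (l', n', 0, l')" "l' \<in> {0, 1}" "n' \<in> {0, 1, \<nu>}"
      using M(2) by (auto elim!: matrices_cases)
    have l: "l' = l"
      using zero(1) J J' p2 by (auto simp: tr_def)
    \<comment> \<open>The traces are \<open>2 * l\<close> on both sides. With this congruence the
      scalar parts cancel from the relations, leaving only \<open>n\<close> and
      \<open>n'\<close>.\<close>
    have dl: "[l = d * l] (mod p)"
    proof -
      have "p dvd 2 * (l - d * l)"
        using tr by (simp add: J J' l tr_def cong_iff_dvd_diff algebra_simps)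
      then show ?thesis using p2(1) unfolding pd cong_iff_dvd_diff by blast
    qed
    have "p dvd n * b"
    proof -
      have "[n * b + l * b' - l * b' = d * (l * b') - d * l * b'] (mod p)"
        using R(4) J J' C l by (intro cong_diff cong_scalar_right dl) simp
      then show ?thesis by (simp add: cong_0_iff)
    qed
    have "p dvd n' * b"
    proof -
      have "[l * a - l * a = d * (l * a + n' * b) - d * l * a] (mod p)"
        using R(1) J J' C l by (intro cong_diff cong_scalar_right dl) simp
      then have "p dvd d * (n' * b)" by (simp add: cong_iff_dvd_diff algebra_simps)
      then show ?thesis using nz pd by blast
    qed
    have na: "[n * a = d * n' * b'] (mod p)"
    proof -
      have "[n * a + l * a' - l * a' = d * (l * a' + n' * b') - d * l * a'] (mod p)"
        using R(3) J J' C l by (intro cong_diff cong_scalar_right dl) simp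
      then show ?thesis by (simp add: algebra_simps)
    qed
    have nu: "\<not> p dvd \<nu>" using \<nu>(1) small by auto
    \<comment> \<open>If \<open>p\<close> divides \<open>b\<close>, then \<open>d\<close> is
      \<open>a * b'\<close> and \<open>n\<close>, \<open>n'\<close> differ by the square of
      \<open>b'\<close>; otherwise both vanish.\<close>
    have "n = n'"
    proof (cases "p dvd b")
      case True
      then have "\<not> p dvd a" "\<not> p dvd b'" using nz by (auto simp: d pd)
      have "[d = a * b'] (mod p)" using True by (simp add: d cong_iff_dvd_diff)
      then have "[d * n' * b' = a * b' * n' * b'] (mod p)" by (intro cong_scalar_right)
      with na have "[a * n = a * (b'\<^sup>2 * n')] (mod p)"
        by (metis (no_types, opaque_lifting) cong_trans mult.assoc mult.commute power2_eq_square)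
      then have *: "[n = b'\<^sup>2 * n'] (mod p)"
        using prime_imp_coprime[OF p(1) \<open>\<not> p dvd a\<close>] by (simp add: cong_mult_lcancel coprime_commute)
      then have "p dvd n \<longleftrightarrow> p dvd n'"
        using cong_dvd_iff[OF *] \<open>\<not> p dvd b'\<close> by (auto simp: pd power2_eq_square)
      then show ?thesis using nonsq[OF *] J J' nu p2 by auto
    next
      case False
      then have "p dvd n" "p dvd n'" using \<open>p dvd n * b\<close> \<open>p dvd n' * b\<close> pd by blast+
      then show ?thesis using J J' nu p2 by auto
    qed
    then show ?thesis using J J' l by simp
  next
    case T: (companion t)
    have "p dvd disc M' \<longleftrightarrow> p dvd disc M" "\<not> p dvd disc M"
      using zero(3) disc_nz[OF M(1)] T by auto
    have "\<not> p dvd tr M'" "\<not> p dvd det M'"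
      using zero(1,2) T small by (auto simp: tr_def det_def)
    then obtain t' where T': "M' = (0, - t', 1, t')" "t' \<in> {1..<p}"
      using M(2) \<open>\<not> p dvd disc M\<close> zero(3) disc_z
      by (elim matrices_cases) (auto simp: tr_def det_def)
    have t: "[t = d * t'] (mod p)" "[t = d\<^sup>2 * t'] (mod p)"
      using tr det T T' by (simp_all add: tr_def det_def)
    \<comment> \<open>As trace and determinant coincide, scaling by \<open>d\<close> and by its
      square agree on \<open>t'\<close>, which forces \<open>d\<close> to act as 1.\<close>
    then have "[d * t' = d\<^sup>2 * t'] (mod p)" by (metis cong_sym cong_trans)
    then have "p dvd d * (t' * (1 - d))" by (simp add: cong_iff_dvd_diff power2_eq_square algebra_simps)
    then have "p dvd t' * (1 - d)" using pd nz by blast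
    then have "[t' = d * t'] (mod p)" by (simp add: cong_iff_dvd_diff algebra_simps)
    then have "[t = t'] (mod p)" using t(1) by (metis cong_sym cong_trans)
    then show ?thesis using small_eq T T' by auto
  next
    case S: (traceless m)
    then have "\<not> p dvd m" using \<nu>(1) small p2 by auto
    then have "p dvd tr M'" "\<not> p dvd det M'"
      using zero(1,2) S by (auto simp: tr_def det_def)
    moreover have "\<not> p dvd disc M'"
      using zero(3) disc_nz[OF M(1)] S by auto
    ultimately obtain m' where S': "M' = (0, m', 1, 0)" "m' \<in> {1, \<nu>}"
      using M(2) disc_z small p2
      by (elim matrices_cases) (auto simp: tr_def det_def)
    have "[- m = d\<^sup>2 * - m'] (mod p)" using det S S' by (simp add: det_def)
    then have "[m = d\<^sup>2 * m'] (mod p)"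
      using cong_minus_minus_iff[of m "d\<^sup>2 * m'" p] by simp
    then show ?thesis using nonsq S S' by auto
  next
    case singular
    then have "\<not> p dvd tr M'" "p dvd det M'"
      using zero(1,2) p2 by (auto simp: tr_def det_def)
    moreover have "\<not> p dvd disc M'"
      using zero(3) disc_nz[OF M(1)] singular by auto
    ultimately show ?thesis
      using M(2) disc_z small p2 \<nu>(1) singular
      by (elim matrices_cases) (auto simp: tr_def det_def)
  qed
qed

theorem theorem4:
  fixes p :: nat
  assumes "Factorial_Ring.prime p" and "p > 3"
  shows "\<exists>S :: nat monoid set. finite S \<and> card S \<ge> p + 8 \<and>
           (\<forall>G\<in>S. beauville_group G \<and> order G = p ^ 5) \<and>
           pairwise (\<lambda>G H. \<not> G \<cong> H) S"
proof -
  define P where "P = int p"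
  have P: "Factorial_Ring.prime P" "P > 3" using assms by (simp_all add: P_def)
  have "P \<noteq> 4" using prime_dvd_mult_iff[OF P(1), of 2 2] by auto
  obtain \<nu> where \<nu>: "\<nu> \<in> {1<..<P}" "\<And>x. \<not> [x\<^sup>2 = \<nu>] (mod P)"
    using P exists_nonsquare_mod[of P] by auto
  let ?M = "matrices P \<nu>" and ?G = "bch_quotient P (P\<^sup>2) 1" and ?E = "bch_quotient P P P (0, 0, 0, 0)"
  define S where "S = insert ?E (?G ` ?M)"
  interpret E: bch_params P P P "(0, 0, 0, 0)"
    using P by (simp add: bch_params_def power2_eq_square)
  have G: "bch_params P (P\<^sup>2) 1" using P by (rule bch_params_square)
  have eq: "M = M'" if M: "M \<in> ?M" "M' \<in> ?M" and iso: "?G M \<cong> ?G M'" for M M'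
  proof -
    obtain \<alpha> \<beta> \<gamma> \<delta> where C: "M = (\<alpha>, \<beta>, \<gamma>, \<delta>)" by (cases M)
    obtain \<alpha>' \<beta>' \<gamma>' \<delta>' where C': "M' = (\<alpha>', \<beta>', \<gamma>', \<delta>')" by (cases M')
    show ?thesis
      using bch_quotient_iso_imp_matrix_relation[OF P iso[unfolded C C']]
        matrices_relation_imp_eq[OF P \<nu> M C C'] by metis
  qed
  have nE: "\<not> ?E \<cong> ?G M" for M using P by (rule bch_quotient_not_iso_exponent_p)
  then have nE': "\<not> ?G M \<cong> ?E" for M
    using group.iso_sym[OF bch_params.group_G[OF G]] by blast
  \<comment> \<open>Equal groups are isomorphic, so inequivalent matrices give distinct members of
    \<open>S\<close> and the count is exact.\<close>
  have "inj_on ?G ?M"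
    using eq iso_refl by (metis inj_onI)
  moreover have "?E \<notin> ?G ` ?M" using nE iso_refl by (metis imageE)
  ultimately have "card S = p + 8" and "finite S"
    using card_matrices[of \<nu> P] \<nu>(1) P(2) \<open>P \<noteq> 4\<close> by (simp_all add: S_def card_image P_def)
  moreover have "beauville_group H \<and> order H = p ^ 5" if "H \<in> S" for H
  proof -
    have "order ?E = p ^ 5" "order (?G M) = p ^ 5" for M
      using E.order_G bch_params.order_G[OF G, of M]
      by (simp_all add: P_def nat_mult_distrib nat_power_eq numeral_eq_Suc)
    then show ?thesis
      using that E.beauville_G bch_params.beauville_G[OF G] by (auto simp: S_def)
  qed
  moreover have "pairwise (\<lambda>G H. \<not> G \<cong> H) S"
    unfolding S_def pairwise_def using eq nE nE' by blast
  ultimately show ?thesis by (intro exI[of _ S]) simp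
qed

end
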